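(* For all $n\in\mathbb{N}$ and $\ell\in\{0,1\}$, one has $$\det\left(\frac{B_{2j+2i+2\ell-2}}{(2j+2i+2\ell-2)!}\right)_{i,j=1}^{n}=(-1)^{n\ell}\,2^{-n(4n+4\ell-1)}\prod_{k=1}^{2n+\ell-1}\left(k+\frac{1}{2}\right)^{k-2n-\ell}$$ and $$\det\left(\frac{G_{2j+2i+2\ell-2}}{(2j+2i+2\ell-2)!}\right)_{i,j=1}^{n}=(-1)^{n(\ell+1)}\,2^{-n(4n+4\ell-2)}\prod_{k=1}^{2n+\ell-1}\left(k-\frac{1}{2}\right)^{k-2n-\ell}.$$
   Context: $\mathbb{N}$ denotes the set of positive integers. $B_m$ are the Bernoulli numbers (with $\sum_{m\ge0}B_m t^m/m!=t/(e^t-1)$, so $B_2=1/6$, $B_4=-1/30$), and $G_m:=2(1-2^m)B_m$ are the Genocchi numbers. *)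

theory Defs
  imports
    Complex_Main
    "HOL-Computational_Algebra.Formal_Power_Series"
    "Jordan_Normal_Form.Determinant"
begin

definition bernoulli :: "nat \<Rightarrow> real" where
  "bernoulli m = fact m * fps_nth (fps_X / (fps_exp 1 - 1)) m"

text \<open>
  The series \<open>fps_exp 1 - 1\<close> is not a unit, so the quotient above relies on the division of
  formal power series cancelling the common factor \<open>fps_X\<close>; the next lemma confirms
  that it is the exact quotient.
\<close>

lemma bernoulli_generating_function:
  "Abs_fps (\<lambda>m. bernoulli m / fact m) * (fps_exp 1 - 1) = fps_X"
proof -
  have nz: "fps_exp (1::real) - 1 \<noteq> 0"
  proof
    assume "fps_exp (1::real) - 1 = 0"
    then have "fps_nth (fps_exp (1::real) - 1) 1 = 0" by simp
    then show False by simp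
  qed
  have "subdegree (fps_exp (1::real) - 1) = 1"
    by (rule subdegreeI) auto
  then have "fps_exp (1::real) - 1 dvd fps_X"
    using nz by (simp add: fps_dvd_iff)
  moreover have "Abs_fps (\<lambda>m. bernoulli m / fact m) = fps_X / (fps_exp 1 - 1)"
    by (rule fps_ext) (simp add: bernoulli_def)
  ultimately show ?thesis by simp
qed

definition genocchi :: "nat \<Rightarrow> real" where
  "genocchi m = 2 * (1 - 2 ^ m) * bernoulli m"

end

theory Submission
  imports Defs
begin

text \<open>
  Put $x = t^2$ and $F_k = \sum_m x^m / (2^m\, m!\, (2k+2m-1)!!)$, so that $F_0 = \cosh t$,
  $F_1 = \sinh t / t$ and $F_k = (2k+1) F_{k+1} + x F_{k+2}$. The series $A_k = F_{k+1} / F_k$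
  are the tails of the continued fraction of $\tanh t$; up to sign and powers of two,
  the numbers $B_{2m} / (2m)!$ are the coefficients of $A_1$ (from $t \coth t$) and the numbers
  $G_{2m} / (2m)!$ those of $A_0$ (from $t \tanh t$).

  If $A = f/g$ and $T$ is the lower triangular Toeplitz matrix of $g$, then
  $T\,(a_{i+j+1})\,T^t$ is the coefficient matrix of the Bezoutian
  $(f(x) g(y) - f(y) g(x)) / (x - y)$, and $T\,(a_{i+j})\,T^t$ that of
  $(x f(x) g(y) - y f(y) g(x)) / (x - y)$. The recurrence for the $F_k$ therefore carries the
  Hankel determinants of $A_k$ to those of $A_{k+1}$.
\<close>

no_notation vec_index (infixl "$" 100)
unbundle fps_syntax

section \<open>Hankel determinants under Toeplitz congruence\<close>

definition hankel_det :: "real fps \<Rightarrow> nat \<Rightarrow> nat \<Rightarrow> real" where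
  "hankel_det a l n = det (mat n n (\<lambda>(i, j). a $ (i + j + l)))"

text \<open>Entry (p, q) of T M T^t for the lower triangular Toeplitz matrix T of \<open>g\<close>.
  Only indices up to p and q enter, so no matrix size appears and both are free for
  induction.\<close>

definition toeplitz_congr :: "real fps \<Rightarrow> (nat \<Rightarrow> nat \<Rightarrow> real) \<Rightarrow> nat \<Rightarrow> nat \<Rightarrow> real" where
  "toeplitz_congr g M p q = (\<Sum>i\<le>p. \<Sum>j\<le>q. g $ (p - i) * g $ (q - j) * M i j)"

text \<open>T is triangular with diagonal entries \<open>g $ 0\<close>, so T and its transpose
  contribute \<open>(g $ 0) ^ n\<close> each.\<close>

lemma det_toeplitz_congr:
  "det (mat n n (\<lambda>(p, q). toeplitz_congr g M p q)) = (g $ 0) ^ (2 * n) * det (mat n n (\<lambda>(i, j). M i j))"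
proof -
  define T where "T = mat n n (\<lambda>(p, i). if i \<le> p then g $ (p - i) else 0)"
  define A where "A = mat n n (\<lambda>(i, j). M i j)"
  have T: "T \<in> carrier_mat n n" and A: "A \<in> carrier_mat n n"
    by (simp_all add: T_def A_def)
  have restrict: "(\<Sum>i<n. if i \<le> p then f i else 0) = (\<Sum>i\<le>p. f i)"
    if "p < n" for p and f :: "nat \<Rightarrow> real"
  proof -
    have "(\<Sum>i<n. if i \<le> p then f i else 0) = sum f {i \<in> {..<n}. i \<le> p}"
      by (rule sum.inter_filter [symmetric]) simp
    also have "{i \<in> {..<n}. i \<le> p} = {..p}" using that by auto
    finally show ?thesis .
  qed
  have "mat n n (\<lambda>(p, q). toeplitz_congr g M p q) = T * (A * transpose_mat T)"
  proof (rule eq_matI)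
    fix p q assume "p < dim_row (T * (A * transpose_mat T))" "q < dim_col (T * (A * transpose_mat T))"
    then have pq: "p < n" "q < n" by (simp_all add: T_def)
    have inner: "(A * transpose_mat T) $$ (i, q) = (\<Sum>j\<le>q. M i j * g $ (q - j))" if "i < n" for i
    proof -
      have "(A * transpose_mat T) $$ (i, q) = (\<Sum>j<n. if j \<le> q then M i j * g $ (q - j) else 0)"
        using that pq by (auto simp: A_def T_def scalar_prod_def lessThan_atLeast0 intro!: sum.cong)
      then show ?thesis using restrict pq by simp
    qed
    have "(T * (A * transpose_mat T)) $$ (p, q) = (\<Sum>i<n. T $$ (p, i) * (A * transpose_mat T) $$ (i, q))"
      using pq by (simp add: A_def T_def scalar_prod_def lessThan_atLeast0)
    also have "\<dots> = (\<Sum>i<n. if i \<le> p then g $ (p - i) * (\<Sum>j\<le>q. M i j * g $ (q - j)) else 0)"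
      using pq inner by (intro sum.cong) (auto simp: T_def)
    also have "\<dots> = (\<Sum>i\<le>p. g $ (p - i) * (\<Sum>j\<le>q. M i j * g $ (q - j)))"
      using restrict pq by simp
    also have "\<dots> = toeplitz_congr g M p q"
      by (simp add: toeplitz_congr_def sum_distrib_left mult_ac)
    finally show "mat n n (\<lambda>(p, q). toeplitz_congr g M p q) $$ (p, q) = (T * (A * transpose_mat T)) $$ (p, q)"
      using pq by simp
  qed (simp_all add: T_def)
  moreover have "det T = (g $ 0) ^ n"
  proof -
    have "det T = prod_list (diag_mat T)"
      by (rule det_lower_triangular [OF _ T]) (simp add: T_def)
    also have "\<dots> = (\<Prod>i = 0..<n. T $$ (i, i))"
      using T by (simp add: prod_list_diag_prod)
    also have "\<dots> = (g $ 0) ^ n"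
      by (simp add: T_def)
    finally show ?thesis .
  qed
  moreover have "det (T * (A * transpose_mat T)) = det T * (det A * det T)"
    using T A by (simp add: det_mult [of _ n] det_transpose [of _ n])
  ultimately show ?thesis
    by (simp add: A_def power_mult power2_eq_square power_mult_distrib)
qed

text \<open>Every term of the Leibniz expansion takes exactly one factor from each row and each
  column.\<close>

lemma det_mat_scale:
  fixes M :: "nat \<Rightarrow> nat \<Rightarrow> real"
  shows "det (mat n n (\<lambda>(i, j). u i * v j * M i j)) = prod u {..<n} * prod v {..<n} * det (mat n n (\<lambda>(i, j). M i j))"
proof -
  have "(\<Prod>i = 0..<n. mat n n (\<lambda>(i, j). u i * v j * M i j) $$ (i, p i)) =
      prod u {..<n} * prod v {..<n} * (\<Prod>i = 0..<n. mat n n (\<lambda>(i, j). M i j) $$ (i, p i))"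
    if p: "p permutes {0..<n}" for p
  proof -
    have "i < n \<Longrightarrow> p i < n" for i using permutes_in_image [OF p, of i] by simp
    then have "(\<Prod>i = 0..<n. mat n n (\<lambda>(i, j). u i * v j * M i j) $$ (i, p i)) =
      (\<Prod>i = 0..<n. u i * v (p i) * mat n n (\<lambda>(i, j). M i j) $$ (i, p i))"
      by (intro prod.cong) auto
    moreover have "(\<Prod>i = 0..<n. v (p i)) = prod v {0..<n}"
      using prod.permute [OF p, of v] by (simp add: o_def)
    ultimately show ?thesis by (simp add: prod.distrib lessThan_atLeast0)
  qed
  then show ?thesis
    by (simp add: det_def sum_distrib_left mult_ac)
qed

section \<open>Shift relations for congruent Hankel matrices\<close>

context
  fixes a g :: "real fps"
begin

abbreviation (input) hankel_congr :: "nat \<Rightarrow> nat \<Rightarrow> nat \<Rightarrow> real" where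
  "hankel_congr l \<equiv> toeplitz_congr g (\<lambda>i j. a $ (i + j + l))"

lemma toeplitz_congr_commute: "(\<And>i j. M i j = M j i) \<Longrightarrow> toeplitz_congr g M p q = toeplitz_congr g M q p"
  unfolding toeplitz_congr_def by (subst sum.swap) (simp add: mult_ac)

lemma hankel_congr_0: "hankel_congr 0 0 q = g $ 0 * (a * g) $ q"
  by (simp add: toeplitz_congr_def fps_mult_nth atMost_atLeast0 sum_distrib_left mult_ac)

text \<open>The summand i = 0 is a Cauchy product; the remaining ones, reindexed, have offset 1.
  Offsets 0 and 1 thus differ by a rank-one term.\<close>

lemma hankel_congr_Suc: "hankel_congr 0 (Suc p) q = hankel_congr 1 p q + g $ Suc p * (a * g) $ q"
  unfolding toeplitz_congr_def
  by (subst sum.atMost_Suc_shift)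
    (simp add: fps_mult_nth atMost_atLeast0 sum_distrib_left mult_ac)

lemma hankel_congr_Suc': "hankel_congr 0 p (Suc q) = hankel_congr 1 p q + (a * g) $ p * g $ Suc q"
  using hankel_congr_Suc [of q p] toeplitz_congr_commute [of "\<lambda>i j. a $ (i + j + 0)" p "Suc q"]
    toeplitz_congr_commute [of "\<lambda>i j. a $ (i + j + 1)" p q]
  by (simp add: add.commute)

end

section \<open>One continued fraction step, formally \<open>a = 1 / (c + fps_X * b)\<close>\<close>

context
  fixes a b g h :: "real fps" and c :: real
  assumes ag: "a * g = h"
    and g: "g = fps_const c * h + fps_X * (b * h)"
begin

lemma denominator_nth_0: "g $ 0 = c * h $ 0" and denominator_nth_Suc: "g $ Suc p = c * h $ Suc p + (b * h) $ p"
  by (simp_all add: g)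

text \<open>Substituting g = c h + x b h into h(x) g(y) - h(y) g(x) cancels the part with c and
  leaves -(x (b h)(x) h(y) - y (b h)(y) h(x)), the numerator that belongs to \<open>b\<close> with
  offset 0.\<close>

lemma hankel_congr_1_step:
  "toeplitz_congr g (\<lambda>i j. a $ (i + j + 1)) p q = - toeplitz_congr h (\<lambda>i j. b $ (i + j + 0)) p q"
proof (induction q arbitrary: p)
  case 0
  show ?case
    using hankel_congr_Suc [of g a p 0] hankel_congr_0 [of g a "Suc p"]
      hankel_congr_0 [of h b p] toeplitz_congr_commute [of "\<lambda>i j. a $ (i + j + 0)" g "Suc p" 0]
      toeplitz_congr_commute [of "\<lambda>i j. b $ (i + j + 0)" h p 0]
    by (simp add: ag denominator_nth_0 denominator_nth_Suc add.commute algebra_simps)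
next
  case (Suc q)
  \<comment> \<open>Two expressions for the entry (p + 1, q + 1) with offset 0 relate (p, q + 1) to
    (p + 1, q) with offset 1, where the induction hypothesis applies.\<close>
  show ?case
    using hankel_congr_Suc [of g a p "Suc q"] hankel_congr_Suc' [of g a "Suc p" q]
      hankel_congr_Suc [of h b p q] hankel_congr_Suc' [of h b p q] Suc [of "Suc p"]
    by (simp add: ag denominator_nth_Suc algebra_simps)
qed

text \<open>The same substitution in x h(x) g(y) - y h(y) g(x), divided by x - y, gives c h(x) h(y)
  minus x y times the Bezoutian of b h and h. The factor x y moves the second block down and right
  by one.\<close>

lemma hankel_congr_0_step:
  "toeplitz_congr g (\<lambda>i j. a $ (i + j + 0)) p q = toeplitz_congr h
     (\<lambda>i j. if i = 0 then if j = 0 then c else 0 else if j = 0 then 0 else - b $ (i - 1 + (j - 1) + 1)) p q"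
  (is "?L p q = toeplitz_congr h ?M p q")
proof -
  have M: "toeplitz_congr h ?M p q = c * h $ p * h $ q -
    (if p = 0 \<or> q = 0 then 0 else toeplitz_congr h (\<lambda>i j. b $ (i + j + 1)) (p - 1) (q - 1))"
    by (cases p; cases q)
      (simp_all add: toeplitz_congr_def sum.atMost_Suc_shift sum_negf mult_ac del: sum.atMost_Suc)
  have L: "?L p q = c * h $ p * h $ q -
    (if p = 0 \<or> q = 0 then 0 else toeplitz_congr h (\<lambda>i j. b $ (i + j + 1)) (p - 1) (q - 1))"
  proof (cases p)
    case 0
    then show ?thesis using hankel_congr_0 [of g a q] by (simp add: ag denominator_nth_0)
  next
    case p: (Suc p')
    show ?thesis
    proof (cases q)
      case 0
      then show ?thesis
        using hankel_congr_0 [of g a p] toeplitz_congr_commute [of "\<lambda>i j. a $ (i + j + 0)" g p 0]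
        by (simp add: ag denominator_nth_0 add.commute)
    next
      case (Suc q')
      \<comment> \<open>The terms \<open>(b * h) $ p' * h $ q\<close> from the two shift relations
        cancel.\<close>
      then show ?thesis
        using hankel_congr_Suc [of g a p' q] hankel_congr_1_step [of p' q]
          hankel_congr_Suc' [of h b p' q'] p
        by (simp add: ag denominator_nth_Suc algebra_simps)
    qed
  qed
  show ?thesis using L M by simp
qed

text \<open>Both sides are the determinant of the same congruent matrix. The powers of
  \<open>g $ 0\<close> and \<open>h $ 0\<close> stay undivided because the context does not say that
  these are nonzero.\<close>

lemma hankel_det_1_step:
  "(g $ 0) ^ (2 * n) * hankel_det a 1 n = (-1) ^ n * (h $ 0) ^ (2 * n) * hankel_det b 0 n"
proof -
  have "(g $ 0) ^ (2 * n) * hankel_det a 1 n =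
      det (mat n n (\<lambda>(p, q). toeplitz_congr h (\<lambda>i j. - b $ (i + j + 0)) p q))"
    unfolding hankel_det_def det_toeplitz_congr [symmetric] hankel_congr_1_step
    by (simp add: toeplitz_congr_def sum_negf)
  \<comment> \<open>The factor \<open>(-1) * 1\<close> gives the entries the shape of
    \<open>det_mat_scale\<close>.\<close>
  also have "\<dots> = (h $ 0) ^ (2 * n) * det (mat n n (\<lambda>(i, j). (-1) * 1 * b $ (i + j + 0)))"
    unfolding det_toeplitz_congr by simp
  also have "det (mat n n (\<lambda>(i, j). (-1) * 1 * b $ (i + j + 0))) = (-1) ^ n * hankel_det b 0 n"
    unfolding hankel_det_def det_mat_scale by simp
  finally show ?thesis by simp
qed

text \<open>The congruent matrix is block diagonal with blocks (c) and -(b_{i+j+1}); expanding along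
  row 0 lowers the size by one.\<close>

lemma hankel_det_0_step:
  "(g $ 0) ^ (2 * Suc n) * hankel_det a 0 (Suc n) =
     (-1) ^ n * c * (h $ 0) ^ (2 * Suc n) * hankel_det b 1 n"
proof -
  let ?M = "\<lambda>i j. if i = 0 then if j = 0 then c else 0 else if j = 0 then 0
    else - b $ (i - 1 + (j - 1) + 1)"
  let ?A = "mat (Suc n) (Suc n) (\<lambda>(i, j). ?M i j)"
  have "(g $ 0) ^ (2 * Suc n) * hankel_det a 0 (Suc n) = (h $ 0) ^ (2 * Suc n) * det ?A"
    unfolding hankel_det_def det_toeplitz_congr [symmetric] hankel_congr_0_step ..
  also have "det ?A = c * det (mat n n (\<lambda>(i, j). (-1) * 1 * b $ (i + j + 1)))"
  proof -
    have "det ?A = (\<Sum>j<Suc n. ?A $$ (0, j) * cofactor ?A 0 j)"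
      by (rule laplace_expansion_row) auto
    also have "\<dots> = ?A $$ (0, 0) * cofactor ?A 0 0"
      by (subst sum.lessThan_Suc_shift) simp
    also have "\<dots> = c * det (mat_delete ?A 0 0)"
      by (simp add: cofactor_def)
    also have "mat_delete ?A 0 0 = mat n n (\<lambda>(i, j). (-1) * 1 * b $ (i + j + 1))"
      by (rule eq_matI) (simp_all add: mat_delete_def)
    finally show ?thesis .
  qed
  also have "det (mat n n (\<lambda>(i, j). (-1) * 1 * b $ (i + j + 1))) = (-1) ^ n * hankel_det b 1 n"
    unfolding hankel_det_def det_mat_scale by simp
  finally show ?thesis by simp
qed

end

section \<open>The series F_k and their quotients A_k\<close>

definition bessel_fps :: "nat \<Rightarrow> real fps" where
  "bessel_fps k = Abs_fps (\<lambda>m. 1 / (2 ^ m * fact m * (\<Prod>i<k + m. 2 * real i + 1)))"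

lemma odd_prod_pos: "(\<Prod>i<k. 2 * real i + 1) > 0"
  by (rule prod_pos) simp

lemma bessel_fps_nth_0: "bessel_fps k $ 0 \<noteq> 0"
  using odd_prod_pos [of k] by (simp add: bessel_fps_def)

text \<open>With \<open>fps_X\<close> read as t^2, this is the recurrence of the modified spherical
  Bessel functions. After clearing denominators, the coefficient of index m amounts to 2 (k + m) + 1
  = (2 k + 1) + 2 m.\<close>

lemma bessel_fps_recurrence:
  "bessel_fps k = fps_const (2 * real k + 1) * bessel_fps (Suc k) + fps_X * bessel_fps (Suc (Suc k))"
proof (rule fps_ext)
  fix m
  have pos: "(\<Prod>i<k'. 2 * real i + 1) \<noteq> 0" for k' using odd_prod_pos [of k'] by simp
  show "bessel_fps k $ m = (fps_const (2 * real k + 1) * bessel_fps (Suc k)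
      + fps_X * bessel_fps (Suc (Suc k))) $ m"
  proof (cases m)
    case 0
    then show ?thesis using pos by (simp add: bessel_fps_def)
  next
    case (Suc m')
    define P where "P = (\<Prod>i<k + m'. 2 * real i + 1)"
    have "P \<noteq> 0" using pos by (simp add: P_def)
    moreover have "1 + real m' \<noteq> 0" "2 * real (k + m') + 1 \<noteq> 0" "2 * real (k + m') + 3 \<noteq> 0"
      by linarith+
    ultimately show ?thesis using Suc
      by (simp add: bessel_fps_def P_def [symmetric] divide_simps)
  qed
qed

definition bessel_ratio :: "nat \<Rightarrow> real fps" where
  "bessel_ratio k = bessel_fps (Suc k) * inverse (bessel_fps k)"

lemma bessel_ratio_mult: "bessel_ratio k * bessel_fps k = bessel_fps (Suc k)"
  unfolding bessel_ratio_def mult.assoc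
  by (simp add: inverse_mult_eq_1 bessel_fps_nth_0)

text \<open>This is the second assumption of the continued fraction step for a = A_k, b = A_{k+1}, g
  = F_k, h = F_{k+1} and c = 2 k + 1.\<close>

lemma bessel_ratio_step:
  "bessel_fps k = fps_const (2 * real k + 1) * bessel_fps (Suc k)
     + fps_X * (bessel_ratio (Suc k) * bessel_fps (Suc k))"
  unfolding bessel_ratio_mult by (rule bessel_fps_recurrence)

lemma hankel_det_bessel_1:
  "hankel_det (bessel_ratio k) 1 n = (-1) ^ n / (2 * real k + 1) ^ (2 * n) * hankel_det (bessel_ratio (Suc k)) 0 n"
proof -
  define c d where "c = 2 * real k + 1" and "d = bessel_fps (Suc k) $ 0"
  have "c > 0" "d \<noteq> 0" using bessel_fps_nth_0 by (auto simp: c_def d_def)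
  moreover have "(c * d) ^ (2 * n) * hankel_det (bessel_ratio k) 1 n =
     (-1) ^ n * d ^ (2 * n) * hankel_det (bessel_ratio (Suc k)) 0 n"
    using hankel_det_1_step [OF bessel_ratio_mult bessel_ratio_step, of k n]
      denominator_nth_0 [OF bessel_ratio_mult bessel_ratio_step, of k]
    by (simp add: c_def d_def)
  ultimately show ?thesis
    unfolding c_def [symmetric] by (simp add: power_mult_distrib field_simps)
qed

lemma hankel_det_bessel_0:
  "hankel_det (bessel_ratio k) 0 (Suc n) =
     (-1) ^ n / (2 * real k + 1) ^ (2 * n + 1) * hankel_det (bessel_ratio (Suc k)) 1 n"
proof -
  \<comment> \<open>Since \<open>bessel_fps k $ 0\<close> is c d, all powers of d cancel, and the
    single c on the right lowers the exponent 2 n + 2 to 2 n + 1.\<close>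
  define c d where "c = 2 * real k + 1" and "d = bessel_fps (Suc k) $ 0"
  have "c > 0" "d \<noteq> 0" using bessel_fps_nth_0 by (auto simp: c_def d_def)
  moreover have "(c * d) ^ (2 * Suc n) * hankel_det (bessel_ratio k) 0 (Suc n) =
     (-1) ^ n * c * d ^ (2 * Suc n) * hankel_det (bessel_ratio (Suc k)) 1 n"
    using hankel_det_0_step [OF bessel_ratio_mult bessel_ratio_step, of k n]
      denominator_nth_0 [OF bessel_ratio_mult bessel_ratio_step, of k]
    by (simp add: c_def d_def)
  ultimately show ?thesis
    unfolding c_def [symmetric] by (simp add: power_mult_distrib field_simps)
qed

section \<open>Closed form of the Hankel determinants of A_k\<close>

definition odd_superprod :: "nat \<Rightarrow> nat \<Rightarrow> real" where
  "odd_superprod k m = (\<Prod>i<m. (2 * real (k + i) + 1) ^ (m - 1 - i))"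

text \<open>Exponents fall from m - 1 to 0 so that removing the first factor matches one Hankel
  step: m = 2 n for offset 1, m = 2 n + 1 for offset 0.\<close>

lemma odd_superprod_Suc: "odd_superprod k (Suc m) = (2 * real k + 1) ^ m * odd_superprod (Suc k) m"
  unfolding odd_superprod_def by (subst prod.lessThan_Suc_shift) (simp add: algebra_simps)

text \<open>Two steps lead from offset 0 through offset 1 back to offset 0, lowering the size by one
  and raising k by two; their signs cancel.\<close>

lemma hankel_det_bessel_0_closed:
  "hankel_det (bessel_ratio k) 0 n = 1 / odd_superprod k (2 * n)"
proof (induction n arbitrary: k)
  case 0
  show ?case by (simp add: hankel_det_def odd_superprod_def)
next
  case (Suc n)
  have "hankel_det (bessel_ratio k) 0 (Suc n) =
     (-1) ^ n / (2 * real k + 1) ^ (2 * n + 1) *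
     ((-1) ^ n / (2 * real (Suc k) + 1) ^ (2 * n) * (1 / odd_superprod (Suc (Suc k)) (2 * n)))"
    unfolding hankel_det_bessel_0 hankel_det_bessel_1 Suc ..
  also have "\<dots> = (-1) ^ n * (-1) ^ n / odd_superprod k (2 * Suc n)"
    by (simp add: odd_superprod_Suc)
  finally show ?case by (simp add: power_add [symmetric])
qed

lemma hankel_det_bessel_closed:
  assumes "l \<in> {0, 1}"
  shows "hankel_det (bessel_ratio k) l n = (-1) ^ (n * l) / odd_superprod k (2 * n + l)"
  using assms hankel_det_bessel_1 [of k n]
  by (auto simp: hankel_det_bessel_0_closed odd_superprod_Suc)

section \<open>Even parts and hyperbolic series\<close>

definition even_part :: "real fps \<Rightarrow> real fps" where
  "even_part a = Abs_fps (\<lambda>i. a $ (2 * i))"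

text \<open>In the coefficient of index 2 n, an odd i pairs with an odd index of \<open>s\<close>,
  where \<open>s\<close> vanishes.\<close>

lemma even_part_mult:
  assumes "\<And>k. odd k \<Longrightarrow> s $ k = 0"
  shows "even_part (a * s) = even_part a * even_part s"
proof (rule fps_ext)
  fix n
  have "(a * s) $ (2 * n) = (\<Sum>i = 0..2 * n. a $ i * s $ (2 * n - i))"
    by (rule fps_mult_nth)
  also have "\<dots> = (\<Sum>i \<in> (*) 2 ` {0..n}. a $ i * s $ (2 * n - i))"
  proof (rule sum.mono_neutral_right)
    show "\<forall>i \<in> {0..2 * n} - (*) 2 ` {0..n}. a $ i * s $ (2 * n - i) = 0"
    proof
      fix i assume i: "i \<in> {0..2 * n} - (*) 2 ` {0..n}"
      then have "odd i" by (auto elim!: evenE)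
      then show "a $ i * s $ (2 * n - i) = 0" using i assms by simp
    qed
  qed auto
  also have "\<dots> = (\<Sum>i = 0..n. a $ (2 * i) * s $ (2 * (n - i)))"
    by (subst sum.reindex) (auto simp: inj_on_def diff_mult_distrib2)
  finally show "even_part (a * s) $ n = (even_part a * even_part s) $ n"
    by (simp add: even_part_def fps_mult_nth)
qed

definition cosh_fps :: "real fps" where
  "cosh_fps = Abs_fps (\<lambda>k. if even k then 1 / fact k else 0)"

text \<open>The series of sinh t / t: dividing by t makes it even.\<close>

definition sinhc_fps :: "real fps" where
  "sinhc_fps = Abs_fps (\<lambda>k. if even k then 1 / fact (Suc k) else 0)"

text \<open>The even factors give 2^m m!, the odd ones the double factorial (2 m - 1)!!.\<close>

lemma fact_double: "fact (2 * m) = (2 ^ m * fact m * (\<Prod>i<m. 2 * real i + 1) :: real)"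
proof (induction m)
  case (Suc m)
  have "fact (2 * Suc m) = (2 * real m + 2) * (2 * real m + 1) * fact (2 * m)"
    by (simp add: algebra_simps)
  then show ?case unfolding Suc by (simp add: algebra_simps)
qed simp

lemma even_part_cosh_fps: "even_part cosh_fps = bessel_fps 0"
proof (rule fps_ext)
  fix m
  have "even_part cosh_fps $ m = 1 / fact (2 * m)"
    by (simp add: even_part_def cosh_fps_def)
  then show "even_part cosh_fps $ m = bessel_fps 0 $ m"
    unfolding fact_double by (simp add: bessel_fps_def)
qed

lemma even_part_sinhc_fps: "even_part sinhc_fps = bessel_fps 1"
proof (rule fps_ext)
  fix m
  have "even_part sinhc_fps $ m = 1 / ((2 * real m + 1) * fact (2 * m))"
    by (simp add: even_part_def sinhc_fps_def add.commute)
  then show "even_part sinhc_fps $ m = bessel_fps 1 $ m"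
    unfolding fact_double by (simp add: bessel_fps_def mult_ac)
qed

lemma cosh_fps_exp: "2 * cosh_fps = fps_exp 1 + fps_exp (- 1)"
  by (rule fps_ext) (simp add: cosh_fps_def numeral_fps_const)

lemma sinhc_fps_exp: "2 * (fps_X * sinhc_fps) = fps_exp 1 - fps_exp (- 1)"
proof (rule fps_ext)
  fix k
  show "(2 * (fps_X * sinhc_fps)) $ k = (fps_exp 1 - fps_exp (- 1) :: real fps) $ k"
    by (cases k) (simp_all add: sinhc_fps_def numeral_fps_const algebra_simps)
qed

section \<open>Bernoulli and Genocchi generating functions\<close>

definition bernoulli_fps :: "real \<Rightarrow> real fps" where
  "bernoulli_fps c = Abs_fps (\<lambda>m. c ^ m * (bernoulli m / fact m))"

lemma bernoulli_fps_mult: "bernoulli_fps c * (fps_exp c - 1) = fps_const c * fps_X"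
proof -
  let ?cX = "fps_const c * fps_X :: real fps"
  have "bernoulli_fps c = Abs_fps (\<lambda>m. bernoulli m / fact m) oo ?cX"
    by (simp add: bernoulli_fps_def fps_compose_linear)
  moreover have "fps_exp c - 1 = (fps_exp 1 - 1) oo ?cX"
    by (simp add: fps_compose_sub_distrib fps_exp_compose_linear)
  ultimately have "bernoulli_fps c * (fps_exp c - 1) =
      (Abs_fps (\<lambda>m. bernoulli m / fact m) * (fps_exp 1 - 1)) oo ?cX"
    by (simp add: fps_compose_mult_distrib)
  then show ?thesis by (simp add: bernoulli_generating_function)
qed

lemma fps_exp_inverse: "fps_exp 1 * fps_exp (- 1 :: real) = 1"
  using fps_exp_add_mult [of 1 "- 1 :: real"] by simp

lemma fps_exp_factor:
  "(fps_exp 1 * fps_exp 1 - 1) * fps_exp (- 1) = fps_exp 1 - fps_exp (- 1 :: real)"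
  "(fps_exp 1 * fps_exp 1 + 1) * fps_exp (- 1) = fps_exp 1 + fps_exp (- 1 :: real)"
  by (simp_all add: left_diff_distrib distrib_right mult.assoc fps_exp_inverse)

lemma fps_exp_2: "fps_exp (2 :: real) = fps_exp 1 * fps_exp 1"
  using fps_exp_add_mult [of 1 "1 :: real"] by simp

lemma fps_exp_4: "fps_exp (4 :: real) = fps_exp 1 * fps_exp 1 * (fps_exp 1 * fps_exp 1)"
  using fps_exp_add_mult [of 2 "2 :: real"] by (simp add: fps_exp_2)

text \<open>This is 2 t / (e^(2 t) - 1) + t = t coth t, seen by multiplying with e^(-t).\<close>

lemma bernoulli_fps_coth: "(bernoulli_fps 2 + fps_X) * sinhc_fps = cosh_fps"
proof -
  let ?E = "fps_exp 1 :: real fps" and ?E' = "fps_exp (- 1) :: real fps"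
  have "bernoulli_fps 2 * (?E * ?E - 1) = 2 * fps_X"
    using bernoulli_fps_mult [of 2] by (simp add: fps_exp_2 numeral_fps_const)
  then have "(bernoulli_fps 2 + fps_X) * (?E * ?E - 1) * ?E' = fps_X * (?E * ?E + 1) * ?E'"
    by (simp add: algebra_simps)
  then have "(bernoulli_fps 2 + fps_X) * (?E - ?E') = fps_X * (?E + ?E')"
    by (simp only: mult.assoc fps_exp_factor)
  then have "(2 * fps_X) * ((bernoulli_fps 2 + fps_X) * sinhc_fps) = (2 * fps_X) * cosh_fps"
    unfolding sinhc_fps_exp [symmetric] cosh_fps_exp [symmetric] by (simp add: mult_ac)
  then show ?thesis by simp
qed

text \<open>The Genocchi series at 2 t, namely 2 B(2 t) - 2 B(4 t), equals 4 t / (e^(2 t) + 1);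
  subtracting 2 t leaves -2 t tanh t.\<close>

lemma bernoulli_fps_tanh:
  "(2 * bernoulli_fps 2 - 2 * bernoulli_fps 4 - 2 * fps_X) * cosh_fps = - 2 * fps_X * (fps_X * sinhc_fps)"
  (is "?G * _ = _")
proof -
  let ?E = "fps_exp 1 :: real fps" and ?E' = "fps_exp (- 1) :: real fps"
  have "bernoulli_fps 2 * (?E * ?E - 1) = 2 * fps_X"
    using bernoulli_fps_mult [of 2] by (simp add: fps_exp_2 numeral_fps_const)
  moreover have "bernoulli_fps 4 * (?E * ?E * (?E * ?E) - 1) = 4 * fps_X"
    using bernoulli_fps_mult [of 4] by (simp add: fps_exp_4 numeral_fps_const)
  \<comment> \<open>Multiplying by both e^(2 t) - 1 and e^(2 t) + 1 clears the denominators of B(2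
    t) and B(4 t) at once.\<close>
  moreover have "(?E * ?E - 1) * (?G * (?E * ?E + 1)) =
      2 * (bernoulli_fps 2 * (?E * ?E - 1)) * (?E * ?E + 1) -
      2 * (bernoulli_fps 4 * (?E * ?E * (?E * ?E) - 1)) - 2 * fps_X * (?E * ?E - 1) * (?E * ?E + 1)"
    by (simp add: algebra_simps)
  ultimately have "(?E * ?E - 1) * (?G * (?E * ?E + 1)) = (?E * ?E - 1) * (- 2 * fps_X * (?E * ?E - 1))"
    by (simp add: algebra_simps)
  moreover have "?E * ?E - 1 \<noteq> 0"
  proof
    assume "?E * ?E - 1 = 0"
    then have "fps_exp 2 - 1 = (0 :: real fps)" by (simp only: fps_exp_2)
    then have "(fps_exp 2 - 1 :: real fps) $ 1 = 0" by (simp only: fps_zero_nth)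
    then show False by simp
  qed
  ultimately have "?G * (?E * ?E + 1) * ?E' = - 2 * fps_X * (?E * ?E - 1) * ?E'"
    by (simp only: mult_cancel_left if_False simp_thms)
  then have "?G * (?E + ?E') = - 2 * fps_X * (?E - ?E')"
    by (simp only: mult.assoc fps_exp_factor)
  then have "2 * (?G * cosh_fps) = 2 * (- 2 * fps_X * (fps_X * sinhc_fps))"
    unfolding sinhc_fps_exp [symmetric] cosh_fps_exp [symmetric] by (simp add: mult_ac)
  then show ?thesis
    by (subst (asm) mult_cancel_left) simp
qed

section \<open>Bernoulli and Genocchi numbers as coefficients of A_1 and A_0\<close>

lemma bernoulli_eq_bessel_ratio:
  "bernoulli (2 * Suc j) / fact (2 * Suc j) = bessel_ratio 1 $ j / 4 ^ Suc j"
proof -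
  let ?S = "even_part (bernoulli_fps 2 + fps_X)"
  have "?S * bessel_fps 1 = bessel_fps 0"
    using even_part_mult [of sinhc_fps "bernoulli_fps 2 + fps_X"]
    by (simp add: bernoulli_fps_coth even_part_cosh_fps even_part_sinhc_fps) (simp add: sinhc_fps_def)
  \<comment> \<open>The recurrence for F_0 turns t coth t into 1 + x A_1, so the index drops from j
    + 1 to j.\<close>
  also have "\<dots> = (1 + fps_X * bessel_ratio 1) * bessel_fps 1"
    using bessel_ratio_step [of 0] by (simp add: algebra_simps)
  finally have "?S = 1 + fps_X * bessel_ratio 1"
    using bessel_fps_nth_0 [of 1] by auto
  then have "?S $ Suc j = (1 + fps_X * bessel_ratio 1) $ Suc j"
    by simp
  then have "2 ^ (2 * Suc j) * (bernoulli (2 * Suc j) / fact (2 * Suc j)) = bessel_ratio 1 $ j"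
    by (simp add: even_part_def bernoulli_fps_def del: fact_Suc mult_Suc_right power_Suc)
  moreover have "(2 :: real) ^ (2 * Suc j) = 4 ^ Suc j"
    by (simp only: power_mult) simp
  ultimately show ?thesis
    by (simp add: field_simps del: fact_Suc mult_Suc_right power_Suc)
qed

lemma genocchi_eq_bessel_ratio:
  "genocchi (2 * Suc j) / fact (2 * Suc j) = - 2 * bessel_ratio 0 $ j / 4 ^ Suc j"
proof -
  let ?G = "2 * bernoulli_fps 2 - 2 * bernoulli_fps 4 - 2 * fps_X"
  have "even_part ?G * bessel_fps 0 = even_part (- 2 * fps_X * (fps_X * sinhc_fps))"
    using even_part_mult [of cosh_fps ?G]
    by (simp add: bernoulli_fps_tanh even_part_cosh_fps) (simp add: cosh_fps_def)
  also have "\<dots> = even_part (- 2 * fps_X * fps_X) * bessel_fps 1"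
    using even_part_mult [of sinhc_fps "- 2 * fps_X * fps_X"]
    by (simp add: even_part_sinhc_fps mult.assoc) (simp add: sinhc_fps_def)
  also have "even_part (- 2 * fps_X * fps_X) = - 2 * fps_X"
    by (rule fps_ext) (auto simp: even_part_def mult.assoc numeral_fps_const)
  finally have "even_part ?G * bessel_fps 0 = (- 2 * fps_X * bessel_ratio 0) * bessel_fps 0"
    using bessel_ratio_mult [of 0] by (simp add: mult.assoc)
  moreover have "bessel_fps 0 \<noteq> 0"
    using bessel_fps_nth_0 [of 0] by auto
  ultimately have "even_part ?G = - 2 * fps_X * bessel_ratio 0"
    by (simp only: mult_cancel_right simp_thms)
  then have "even_part ?G $ Suc j = (- 2 * fps_X * bessel_ratio 0) $ Suc j"
    by simp
  \<comment> \<open>This excludes index 1, so \<open>2 * fps_X\<close> contributes nothing.\<close>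
  moreover have "\<not> 2 * Suc j \<le> Suc 0"
    by simp
  ultimately have "2 * (2 ^ (2 * Suc j) - 4 ^ (2 * Suc j)) * (bernoulli (2 * Suc j) / fact (2 * Suc j)) =
      - 2 * bessel_ratio 0 $ j"
    by (simp add: even_part_def bernoulli_fps_def numeral_fps_const mult.assoc left_diff_distrib
          right_diff_distrib diff_divide_distrib
        del: fact_Suc mult_Suc_right power_Suc)
  \<comment> \<open>The difference then factors as \<open>4 ^ Suc j * (1 - 4 ^ Suc j)\<close>, whose
    second factor is that of the Genocchi number.\<close>
  moreover have "(2 :: real) ^ (2 * Suc j) = 4 ^ Suc j" "(4 :: real) ^ (2 * Suc j) = 4 ^ Suc j * 4 ^ Suc j"
    by (simp only: power_mult, simp) (simp only: mult_2 power_add)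
  ultimately show ?thesis
    by (simp add: genocchi_def field_simps del: fact_Suc mult_Suc_right power_Suc)
qed

section \<open>Powers of two and half-integer factors\<close>

lemma hankel_det_scale:
  "det (mat n n (\<lambda>(i, j). r * (a $ (i + j + l) / 4 ^ Suc (i + j + l)))) =
    r ^ n * hankel_det a l n / 2 ^ (2 * n * (n + l))"
proof -
  \<comment> \<open>The exponent of 4: each of the n rows carries l + 1, and the weights 4^i and 4^j
    each add the sum of the indices.\<close>
  have gauss: "n * (l + 1) + 2 * (\<Sum>i<n. i) = n * (n + l)"
    by (induction n) auto
  have "det (mat n n (\<lambda>(i, j). r * (a $ (i + j + l) / 4 ^ Suc (i + j + l)))) =
      det (mat n n (\<lambda>(i, j). (r / 4 ^ (l + 1) * (1 / 4 ^ i)) * (1 / 4 ^ j) * a $ (i + j + l)))"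
    by (intro arg_cong [of _ _ det] cong_mat) (auto simp: power_add)
  also have "\<dots> = (r / 4 ^ (l + 1)) ^ n * (1 / 4 ^ (\<Sum>i<n. i)) * (1 / 4 ^ (\<Sum>i<n. i)) * hankel_det a l n"
    unfolding det_mat_scale hankel_det_def
    by (simp add: prod.distrib prod_dividef power_sum power_divide power_mult_distrib)
  also have "\<dots> = r ^ n * hankel_det a l n / 4 ^ (n * (l + 1) + 2 * (\<Sum>i<n. i))"
    by (simp add: power_add power_divide power_mult [symmetric] mult_2 mult_2_right algebra_simps)
  also have "\<dots> = r ^ n * hankel_det a l n / 2 ^ (2 * n * (n + l))"
    unfolding gauss by (simp add: power_mult mult.assoc)
  finally show ?thesis .
qed

lemma powi_neg_diff_eq:
  assumes "i \<le> m"
  shows "(x :: real) powi (int i - int m) = 1 / x ^ (m - i)"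
proof -
  have "int i - int m = - int (m - i)" using assms by simp
  then show ?thesis
    by (simp only: power_int_minus power_int_of_nat divide_inverse mult_1_left)
qed

text \<open>Each factor is 2 (k + i) + 1 = 2 ((i + 1) + (k - 1/2)). The twos collect to a triangular
  number, and the index moves up by one.\<close>

lemma odd_superprod_powi:
  assumes "m \<ge> 1"
  shows "1 / odd_superprod k m =
    1 / 2 ^ (m * (m - 1) div 2) * (\<Prod>i = 1..m - 1. (real i + (real k - 1 / 2)) powi (int i - int m))"
proof -
  obtain m' where m: "m = Suc m'" using assms by (cases m) auto
  have gauss: "(\<Sum>i<m'. m' - i) = Suc m' * m' div 2"
  proof -
    have "(\<Sum>i<m'. m' - i) = (\<Sum>i<m'. Suc i)"
      by (subst sum.nat_diff_reindex [symmetric]) (rule sum.cong, auto)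
    also have "2 * \<dots> = Suc m' * m'" by (induction m') auto
    finally show ?thesis by simp
  qed
  have "odd_superprod k m = (\<Prod>i<m'. (2 * real (k + i) + 1) ^ (m' - i))"
    by (simp add: odd_superprod_def m)
  also have "\<dots> = (\<Prod>i<m'. 2 ^ (m' - i) * (real (Suc i) + (real k - 1 / 2)) ^ (m' - i))"
    unfolding power_mult_distrib [symmetric] by (rule prod.cong) (auto simp: algebra_simps)
  also have "\<dots> = 2 ^ (m * (m - 1) div 2) * (\<Prod>i<m'. (real (Suc i) + (real k - 1 / 2)) ^ (m' - i))"
    by (simp add: prod.distrib power_sum [symmetric] gauss m)
  also have "(\<Prod>i<m'. (real (Suc i) + (real k - 1 / 2)) ^ (m' - i)) =
      (\<Prod>i = 1..m'. (real i + (real k - 1 / 2)) ^ (m - i))"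
    by (rule prod.reindex_bij_witness [of _ "\<lambda>i. i - 1" Suc]) (auto simp: m)
  finally have "1 / odd_superprod k m =
      1 / 2 ^ (m * (m - 1) div 2) * (\<Prod>i = 1..m - 1. 1 / (real i + (real k - 1 / 2)) ^ (m - i))"
    by (simp add: m prod_dividef)
  also have "(\<Prod>i = 1..m - 1. 1 / (real i + (real k - 1 / 2)) ^ (m - i)) =
      (\<Prod>i = 1..m - 1. (real i + (real k - 1 / 2)) powi (int i - int m))"
    by (rule prod.cong) (simp, subst powi_neg_diff_eq, auto)
  finally show ?thesis .
qed

text \<open>Common form of both evaluations: r = 1, k = 1 for Bernoulli and r = -2, k = 0 for
  Genocchi numbers.\<close>

lemma hankel_det_bessel_powi:
  assumes "n \<ge> 1" "l \<in> {0, 1}"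
  shows "det (mat n n (\<lambda>(i, j). r * (bessel_ratio k $ (i + j + l) / 4 ^ Suc (i + j + l)))) =
    r ^ n * (-1) ^ (n * l) / 2 ^ (n * (4 * n + 4 * l - 1)) *
    (\<Prod>i = 1..2 * n + l - 1. (real i + (real k - 1 / 2)) powi (int i - 2 * int n - int l))"
proof -
  let ?m = "2 * n + l"
  \<comment> \<open>In general the two sides differ by l (l - 1) / 2, which vanishes for l = 0 and l
    = 1.\<close>
  have expo: "2 * n * (n + l) + ?m * (?m - 1) div 2 = n * (4 * n + 4 * l - 1)"
  proof -
    obtain n' where "n = Suc n'" using assms by (cases n) auto
    then show ?thesis using assms(2) by (auto simp: algebra_simps)
  qed
  have "det (mat n n (\<lambda>(i, j). r * (bessel_ratio k $ (i + j + l) / 4 ^ Suc (i + j + l)))) =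
      r ^ n * (-1) ^ (n * l) / 2 ^ (2 * n * (n + l)) * (1 / odd_superprod k ?m)"
    unfolding hankel_det_scale hankel_det_bessel_closed [OF assms(2)] by simp
  also have "1 / odd_superprod k ?m = 1 / 2 ^ (?m * (?m - 1) div 2) *
      (\<Prod>i = 1..?m - 1. (real i + (real k - 1 / 2)) powi (int i - int ?m))"
    using assms by (intro odd_superprod_powi) simp
  finally show ?thesis
    unfolding expo [symmetric] by (simp add: power_add algebra_simps)
qed

theorem corollary7:
  fixes n l :: nat
  assumes "n \<ge> 1" and "l \<in> {0, 1}"
  shows "det (mat n n (\<lambda>(i, j).
            bernoulli (2 * (j + 1) + 2 * (i + 1) + 2 * l - 2)
              / fact (2 * (j + 1) + 2 * (i + 1) + 2 * l - 2)))
         = (-1) ^ (n * l) * 2 powi (- (int n * (4 * int n + 4 * int l - 1)))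
           * (\<Prod>k = 1..2 * n + l - 1. (real k + 1 / 2) powi (int k - 2 * int n - int l))
    \<and> det (mat n n (\<lambda>(i, j).
            genocchi (2 * (j + 1) + 2 * (i + 1) + 2 * l - 2)
              / fact (2 * (j + 1) + 2 * (i + 1) + 2 * l - 2)))
         = (-1) ^ (n * (l + 1)) * 2 powi (- (int n * (4 * int n + 4 * int l - 2)))
           * (\<Prod>k = 1..2 * n + l - 1. (real k - 1 / 2) powi (int k - 2 * int n - int l))"
proof -
  have index: "2 * (j + 1) + 2 * (i + 1) + 2 * l - 2 = 2 * Suc (i + j + l)" for i j
    by simp
  have powi: "2 powi (- int e) = (1 / 2 ^ e :: real)" for e
    by (simp add: power_int_minus divide_inverse)
  \<comment> \<open>As n is positive, the subtraction on naturals does not truncate.\<close>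
  have e1: "int n * (4 * int n + 4 * int l - 1) = int (n * (4 * n + 4 * l - 1))"
    using assms by (simp add: of_nat_diff)
  have e2: "int n * (4 * int n + 4 * int l - 2) = int (n * (4 * n + 4 * l - 2))"
    using assms by (simp add: of_nat_diff)
  have "4 * n + 4 * l - 1 = Suc (4 * n + 4 * l - 2)"
    using assms by simp
  then have "n * (4 * n + 4 * l - 1) = n + n * (4 * n + 4 * l - 2)"
    by (simp only: mult_Suc_right)
  then have two: "(2 :: real) ^ (n * (4 * n + 4 * l - 1)) = 2 ^ n * 2 ^ (n * (4 * n + 4 * l - 2))"
    by (simp add: power_add)
  \<comment> \<open>The factor (-2)^n accounts for both differences between the formulas: 2^n lowers
    the exponent of 1/2 by n, and (-1)^n turns n l into n (l + 1).\<close>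
  have sign: "(- 2 :: real) ^ n * (-1) ^ (n * l) = 2 ^ n * (-1) ^ (n * (l + 1))"
    by (simp add: power_minus [of 2] power_add)
  show ?thesis
    unfolding index bernoulli_eq_bessel_ratio genocchi_eq_bessel_ratio e1 e2 powi
    using hankel_det_bessel_powi [OF assms, of 1 1] hankel_det_bessel_powi [OF assms, of "- 2" 0]
    unfolding sign unfolding two by simp
qed

end
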